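(* Fix positive integers $t\le a\le b$. Let $(A_1,B_1),\dots,(A_m,B_m)$ be a collection of pairs of subspaces of a real vector space $V$ with $\dim A_i=a$ and $\dim B_i=b$ for $1\le i\le m$. Suppose that (i) $\dim(A_i\cap B_i)=0$ for $1\le i\le m$, (ii) $\dim(A_i\cap B_j)>0$ for $1\le i<j\le m$, and (iii) $\dim(A_i\cap A_j)\ge t$ for $1\le i,j\le m$. Then $m\le AK(a+b,a,t)$.
   Context: $[n]=\{1,\dots,n\}$. A family $\mathcal A$ of subsets of $[n]$ is $t$-intersecting if $|A\cap B|\ge t$ for all $A,B\in\mathcal A$ (including $A=B$), and $a$-uniform if all its members have exactly $a$ elements. $AK(n,a,t)$ denotes the maximum size of an $a$-uniform $t$-intersecting family of subsets of $[n]$. *)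

theory Defs
  imports "HOL-Analysis.Analysis"
begin

definition t_intersecting :: "nat \<Rightarrow> nat set set \<Rightarrow> bool" where
  "t_intersecting t F \<longleftrightarrow> (\<forall>A\<in>F. \<forall>B\<in>F. t \<le> card (A \<inter> B))"

definition uniform_family :: "nat \<Rightarrow> nat set set \<Rightarrow> bool" where
  "uniform_family a F \<longleftrightarrow> (\<forall>A\<in>F. card A = a)"

(* The maximum is over a finite nonempty set: F ranges over subsets of Pow {1..n},
   and the empty family always qualifies. *)
definition AK :: "nat \<Rightarrow> nat \<Rightarrow> nat \<Rightarrow> nat" where
  "AK n a t = Max {card F | F. F \<subseteq> Pow {1..n} \<and> uniform_family a F \<and> t_intersecting t F}"

end

theory Submission
  imports Defs "Jordan_Normal_Form.Determinant" "HOL-Library.Nat_Bijection"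
begin

text \<open>
  The proof works in the exterior algebra, written out in coordinates. Put \<open>n = a + b\<close>. A
  projection in general position (\<open>generic_functionals\<close>) maps \<open>V\<close> to an
  \<open>n\<close>-dimensional space and is injective on every \<open>A i + B i\<close>, so it preserves what is
  assumed about the pairs. After that, each \<open>A i\<close> is represented by the exterior product
  \<open>f i\<close> of a basis, that is, by the function that sends an \<open>a\<close>-tuple of
  coordinates to the corresponding \<open>minor\<close>.

  The hypotheses on \<open>A i \<inter> B j\<close> say that \<open>f i \<and> B j\<close> is zero for \<open>i < j\<close>
  and nonzero for \<open>i = j\<close>. By triangularity the \<open>f i\<close> are linearly independent.

  The hypothesis \<open>dim (A i \<inter> A j) \<ge> t\<close> has a bilinear consequence. Contracting
  \<open>f j\<close> by \<open>t - 1\<close> covectors gives a combination of exterior products of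
  \<open>a + 1 - t\<close> vectors of \<open>A j\<close>; the span of such vectors meets \<open>A i\<close>
  nontrivially, so its exterior product with \<open>f i\<close> is zero
  (\<open>intersection_meets_partial_basis\<close>, \<open>alt_product_contract_eq_0\<close>). Hence all
  \<open>f\<close> and \<open>g\<close> in the span \<open>W\<close> of the \<open>f i\<close> satisfy: the product of
  \<open>f\<close> with any contraction of \<open>g\<close> by \<open>t - 1\<close> basis covectors is zero.

  Finally, \<open>W\<close> is replaced by the family of the leading sets of its nonzero elements, for a total
  order of the \<open>a\<close>-subsets of \<open>{..<n}\<close> that is compatible with products. A space of dimension
  \<open>m\<close> has at least \<open>m\<close> leading sets (\<open>card_leading_sets_ge\<close>). If two of them,
  \<open>S\<close> and \<open>T\<close>, had fewer than \<open>t\<close> common elements, then contracting away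
  \<open>t - 1\<close> elements of \<open>T\<close> that include \<open>S \<inter> T\<close> would leave disjoint leading
  sets, whose product cannot vanish
  (\<open>alt_product_contract_leading_nonzero\<close>). So the leading sets form an
  \<open>a\<close>-uniform \<open>t\<close>-intersecting family with at least \<open>m\<close> members.
\<close>

section \<open>Minors\<close>

definition minor :: "nat \<Rightarrow> (nat \<Rightarrow> nat \<Rightarrow> real) \<Rightarrow> (nat \<Rightarrow> nat) \<Rightarrow> real" where
  "minor k v \<sigma> = (\<Sum>p | p permutes {..<k}. of_int (sign p) * (\<Prod>i<k. v i (\<sigma> (p i))))"

lemma minor_eq_det: "minor k v \<sigma> = det (mat k k (\<lambda>(i, j). v i (\<sigma> j)))"
proof -
  have "det (mat k k (\<lambda>(i, j). v i (\<sigma> j)))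
      = (\<Sum>p | p permutes {0..<k}. of_int (sign p) *
          (\<Prod>i = 0..<k. mat k k (\<lambda>(i, j). v i (\<sigma> j)) $$ (i, p i)))"
    by (rule det_def') simp
  also have "\<dots> = (\<Sum>p | p permutes {0..<k}. of_int (sign p) * (\<Prod>i = 0..<k. v i (\<sigma> (p i))))"
    by (intro sum.cong prod.cong arg_cong2[of _ _ _ _ "(*)"] refl)
      (auto dest: permutes_in_image simp: permutes_in_image)
  finally show ?thesis
    by (simp add: minor_def lessThan_atLeast0)
qed

text \<open>
  The same determinant expanded over permutations of the rows. In this form the column tuple
  \<open>\<sigma>\<close> enters only through \<open>\<sigma> i\<close> for \<open>i < k\<close>, so that
  some of its entries can be frozen.
\<close>

lemma minor_expand_rows:
  "minor k v \<sigma> = (\<Sum>p | p permutes {..<k}. of_int (sign p) * (\<Prod>i<k. v (p i) (\<sigma> i)))"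
proof -
  have "minor k v \<sigma> = det (mat k k (\<lambda>(j, i). v i (\<sigma> j)))"
    unfolding minor_eq_det
    by (subst det_transpose[symmetric, of _ k])
      (auto simp: transpose_mat_def intro!: arg_cong[of _ _ det] eq_matI)
  also have "\<dots> = (\<Sum>p | p permutes {0..<k}. of_int (sign p) *
          (\<Prod>i = 0..<k. mat k k (\<lambda>(j, i). v i (\<sigma> j)) $$ (i, p i)))"
    by (rule det_def') simp
  also have "\<dots> = (\<Sum>p | p permutes {0..<k}. of_int (sign p) * (\<Prod>i = 0..<k. v (p i) (\<sigma> i)))"
    by (intro sum.cong prod.cong arg_cong2[of _ _ _ _ "(*)"] refl)
      (auto dest: permutes_in_image simp: permutes_in_image)
  finally show ?thesis
    by (simp add: lessThan_atLeast0)
qed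

lemma minor_eq_0_iff:
  "minor k v \<sigma> = 0 \<longleftrightarrow>
    (\<exists>z. (\<exists>i<k. z i \<noteq> 0) \<and> (\<forall>j<k. (\<Sum>i<k. z i * v i (\<sigma> j)) = 0))" (is "_ \<longleftrightarrow> ?R")
proof -
  let ?M = "mat k k (\<lambda>(j, i). v i (\<sigma> j))"
  have "minor k v \<sigma> = det ?M"
    unfolding minor_eq_det
    by (subst det_transpose[symmetric, of _ k])
      (auto simp: transpose_mat_def intro!: arg_cong[of _ _ det] eq_matI)
  then have "minor k v \<sigma> = 0 \<longleftrightarrow>
      (\<exists>x. x \<in> carrier_vec k \<and> x \<noteq> 0\<^sub>v k \<and> ?M *\<^sub>v x = 0\<^sub>v k)"
    by (simp add: det_0_iff_vec_prod_zero[of _ k])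
  also have "\<dots> \<longleftrightarrow> ?R"
  proof
    assume "\<exists>x. x \<in> carrier_vec k \<and> x \<noteq> 0\<^sub>v k \<and> ?M *\<^sub>v x = 0\<^sub>v k"
    then obtain x where x: "x \<in> carrier_vec k" "x \<noteq> 0\<^sub>v k" "?M *\<^sub>v x = 0\<^sub>v k"
      by blast
    have "\<exists>i<k. vec_index x i \<noteq> 0"
      using x(1,2) by (metis carrier_vecD eq_vecI index_zero_vec)
    moreover have "(\<Sum>i<k. vec_index x i * v i (\<sigma> j)) = 0" if "j < k" for j
    proof -
      have "vec_index (?M *\<^sub>v x) j = 0"
        using x(3) that by simp
      then show ?thesis
        using x(1) that by (simp add: scalar_prod_def lessThan_atLeast0 mult.commute)
    qed
    ultimately show ?R
      by blast
  next
    assume ?R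
    then obtain z i where z: "i < k" "z i \<noteq> 0" "\<forall>j<k. (\<Sum>i<k. z i * v i (\<sigma> j)) = 0"
      by blast
    have "vec k z \<noteq> 0\<^sub>v k"
      using z(1,2) by (metis index_vec index_zero_vec(1))
    moreover have "?M *\<^sub>v vec k z = 0\<^sub>v k"
      using z(3) by (intro eq_vecI) (simp_all add: scalar_prod_def lessThan_atLeast0 mult.commute)
    ultimately show "\<exists>x. x \<in> carrier_vec k \<and> x \<noteq> 0\<^sub>v k \<and> ?M *\<^sub>v x = 0\<^sub>v k"
      by (intro exI[of _ "vec k z"]) simp
  qed
  finally show ?thesis .
qed

text \<open>
  Both dimension counts of the proof rest on this fact about homogeneous systems: the one that bounds
  the number of leading sets from below, and the one inside a single subspace. The unknowns are the
  \<open>z i\<close>, with one equation for each element of \<open>L\<close>.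
\<close>

lemma homogeneous_system_nontrivial:
  fixes f :: "nat \<Rightarrow> 'x \<Rightarrow> real"
  assumes "finite L" "card L < m"
  shows "\<exists>z. (\<exists>i<m. z i \<noteq> 0) \<and> (\<forall>x\<in>L. (\<Sum>i<m. z i * f i x) = 0)"
proof -
  obtain e where e: "bij_betw e {..<card L} L"
    using ex_bij_betw_nat_finite[OF assms(1)] by (auto simp: lessThan_atLeast0)
  define v where "v i j = (if j < card L then f i (e j) else 0)" for i j
  \<comment> \<open>Padding by zero columns (column \<open>card L\<close> is one of them) makes the matrix square and singular.\<close>
  have "minor m v id = 0"
    unfolding minor_expand_rows
  proof (intro sum.neutral ballI)
    fix p assume "p \<in> {p. p permutes {..<m}}"
    have "v (p (card L)) (id (card L)) = 0"
      by (simp add: v_def)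
    then show "of_int (sign p) * (\<Prod>i<m. v (p i) (id i)) = 0"
      using assms(2) by (auto intro!: prod_zero)
  qed
  then obtain z where z: "\<exists>i<m. z i \<noteq> 0" "\<forall>j<m. (\<Sum>i<m. z i * v i j) = 0"
    by (auto simp: minor_eq_0_iff)
  have "(\<Sum>i<m. z i * f i x) = 0" if "x \<in> L" for x
  proof -
    obtain j where "j < card L" "x = e j"
      using e \<open>x \<in> L\<close> by (auto simp: bij_betw_def)
    then show ?thesis
      using z(2)[rule_format, of j] assms(2) by (simp add: v_def)
  qed
  with z(1) show ?thesis
    by blast
qed

section \<open>Alternating functions of index tuples\<close>

text \<open>
  Elements of the exterior power \<open>\<Lambda>\<^sup>k\<close> are represented by their coordinate
  functions. An index tuple is a function on all of \<open>nat\<close> of which only the first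
  \<open>k\<close> values count, which is the first clause. It is enough to ask for the sign change
  under transpositions, and this is easier to verify than the one under all permutations.
\<close>

definition alternating :: "nat \<Rightarrow> ((nat \<Rightarrow> nat) \<Rightarrow> real) \<Rightarrow> bool" where
  "alternating k f \<longleftrightarrow>
    (\<forall>\<sigma> \<tau>. (\<forall>i<k. \<sigma> i = \<tau> i) \<longrightarrow> f \<sigma> = f \<tau>) \<and>
    (\<forall>\<sigma> i j. i < k \<longrightarrow> j < k \<longrightarrow> i \<noteq> j \<longrightarrow> f (\<sigma> \<circ> Transposition.transpose i j) = - f \<sigma>)"

lemma alternating_cong:
  assumes "alternating k f" "\<And>i. i < k \<Longrightarrow> \<sigma> i = \<tau> i"
  shows "f \<sigma> = f \<tau>"
  using assms unfolding alternating_def by blast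

lemma alternating_linear_combination:
  assumes "\<And>i. i \<in> I \<Longrightarrow> alternating k (f i)"
  shows "alternating k (\<lambda>\<sigma>. \<Sum>i\<in>I. z i * f i \<sigma>)"
  using assms unfolding alternating_def
  by (auto simp: sum_negf[symmetric] intro!: sum.cong)

text \<open>
  Stated for an arbitrary finite set \<open>X\<close> of positions, because a product of two alternating
  functions is antisymmetric separately in two blocks of positions.
\<close>

lemma sign_of_transposition_antisymmetric:
  fixes F :: "(nat \<Rightarrow> nat) \<Rightarrow> real"
  assumes "\<And>\<sigma> i j. i \<in> X \<Longrightarrow> j \<in> X \<Longrightarrow> i \<noteq> j \<Longrightarrow> F (\<sigma> \<circ> Transposition.transpose i j) = - F \<sigma>"
    and "finite X" "p permutes X"
  shows "F (\<sigma> \<circ> p) = of_int (sign p) * F \<sigma>"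
  using assms(2,3)
proof (induction rule: permutes_rev_induct)
  case id
  then show ?case by simp
next
  case (swap i j p)
  have "permutation p"
    using swap assms(2) by (auto simp: permutation_permutes)
  then have "sign (p \<circ> Transposition.transpose i j) = - sign p"
    using swap by (simp add: sign_compose sign_swap_id permutation_swap_id)
  moreover have "F (\<sigma> \<circ> (p \<circ> Transposition.transpose i j)) = - F (\<sigma> \<circ> p)"
    unfolding o_assoc using swap by (intro assms(1))
  moreover have "F (\<sigma> \<circ> p) = of_int (sign p) * F \<sigma>"
    using swap by blast
  ultimately show ?case
    by (simp only: of_int_minus minus_mult_left)
qed

lemma alternating_permute:
  assumes "alternating k f" "p permutes {..<k}"
  shows "f (\<sigma> \<circ> p) = of_int (sign p) * f \<sigma>"
proof (rule sign_of_transposition_antisymmetric[of "{..<k}"])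
  show "f (\<sigma> \<circ> Transposition.transpose i j) = - f \<sigma>"
    if "i \<in> {..<k}" "j \<in> {..<k}" "i \<noteq> j" for \<sigma> i j
    using assms(1) that unfolding alternating_def by blast
qed (use assms(2) in auto)

lemma alternating_inj_on:
  assumes "alternating k f" "f \<sigma> \<noteq> 0"
  shows "inj_on \<sigma> {..<k}"
proof (rule inj_onI, rule ccontr)
  fix i j assume ij: "i \<in> {..<k}" "j \<in> {..<k}" "\<sigma> i = \<sigma> j" "i \<noteq> j"
  have "\<sigma> \<circ> Transposition.transpose i j = \<sigma>"
    using ij by (auto simp: fun_eq_iff Transposition.transpose_def)
  moreover have "f (\<sigma> \<circ> Transposition.transpose i j) = - f \<sigma>"
    using assms(1) ij unfolding alternating_def by blast
  ultimately show False
    using assms(2) by simp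
qed

text \<open>
  Up to sign, an alternating function depends only on the set of indices in the tuple. This is what
  makes the leading set of such a function meaningful.
\<close>

lemma alternating_same_image:
  assumes "alternating k f" "f \<tau> \<noteq> 0" "\<sigma> ` {..<k} = \<tau> ` {..<k}"
  shows "f \<sigma> \<noteq> 0"
proof -
  have \<tau>: "inj_on \<tau> {..<k}"
    using alternating_inj_on[OF assms(1,2)] .
  have "card (\<sigma> ` {..<k}) = k"
    using \<tau> assms(3) by (simp add: card_image)
  then have \<sigma>: "inj_on \<sigma> {..<k}"
    by (intro eq_card_imp_inj_on) auto
  define p where "p i = (if i < k then inv_into {..<k} \<tau> (\<sigma> i) else i)" for i
  have "bij_betw (inv_into {..<k} \<tau> \<circ> \<sigma>) {..<k} {..<k}"
  proof (rule bij_betw_trans)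
    show "bij_betw \<sigma> {..<k} (\<tau> ` {..<k})"
      using \<sigma> assms(3) by (simp add: bij_betw_def)
    show "bij_betw (inv_into {..<k} \<tau>) (\<tau> ` {..<k}) {..<k}"
      using \<tau> by (intro bij_betw_inv_into) (simp add: bij_betw_def)
  qed
  then have "bij_betw p {..<k} {..<k}"
    by (subst bij_betw_cong[where g = "inv_into {..<k} \<tau> \<circ> \<sigma>"]) (simp_all add: p_def)
  then have p: "p permutes {..<k}"
    by (rule bij_imp_permutes) (simp add: p_def)
  have "(\<tau> \<circ> p) i = \<sigma> i" if "i < k" for i
    using assms(3) that by (auto simp: p_def intro!: f_inv_into_f)
  then have "f \<sigma> = f (\<tau> \<circ> p)"
    using alternating_cong[OF assms(1), of \<sigma> "\<tau> \<circ> p"] by simp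
  also have "\<dots> = of_int (sign p) * f \<tau>"
    by (rule alternating_permute[OF assms(1) p])
  finally show ?thesis
    using assms(2) by (simp add: sign_def)
qed

text \<open>
  The maximal minors of \<open>k\<close> independent row vectors, as a function of the columns, are the
  Pluecker coordinates of the subspace that the vectors span.
\<close>

lemma alternating_minor: "alternating k (minor k v)"
  unfolding alternating_def
proof (intro conjI allI impI)
  fix \<sigma> \<tau> :: "nat \<Rightarrow> nat"
  assume "\<forall>i<k. \<sigma> i = \<tau> i"
  then show "minor k v \<sigma> = minor k v \<tau>"
    by (simp add: minor_expand_rows)
next
  fix \<sigma> :: "nat \<Rightarrow> nat" and i j
  assume ij: "i < k" "j < k" "i \<noteq> j"
  let ?t = "Transposition.transpose i j"
  have t: "?t permutes {..<k}"
    using ij by (intro permutes_swap_id) auto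
  have "minor k v (\<sigma> \<circ> ?t) = (\<Sum>p | p permutes {..<k}. of_int (sign p) * (\<Prod>i<k. v i (\<sigma> ((?t \<circ> p) i))))"
    by (simp add: minor_def)
  also have "\<dots> = (\<Sum>p | p permutes {..<k}. - (of_int (sign (?t \<circ> p)) * (\<Prod>i<k. v i (\<sigma> ((?t \<circ> p) i)))))"
  proof (intro sum.cong refl)
    fix p assume "p \<in> {p. p permutes {..<k}}"
    then have "permutation p"
      by (auto simp: permutation_permutes)
    then show "of_int (sign p) * (\<Prod>i<k. v i (\<sigma> ((?t \<circ> p) i)))
        = - (of_int (sign (?t \<circ> p)) * (\<Prod>i<k. v i (\<sigma> ((?t \<circ> p) i))))"
      using ij by (simp add: sign_compose sign_swap_id permutation_swap_id)
  qed
  also have "\<dots> = - minor k v \<sigma>"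
    unfolding minor_def sum_negf
    by (subst (2) setum_permutations_compose_left[OF t]) simp
  finally show "minor k v (\<sigma> \<circ> ?t) = - minor k v \<sigma>" .
qed

section \<open>Antisymmetrized products\<close>

lemma prod_lessThan_add:
  fixes h :: "nat \<Rightarrow> 'a::comm_monoid_mult"
  shows "(\<Prod>i<a + q. h i) = (\<Prod>i<a. h i) * (\<Prod>k<q. h (a + k))"
  by (induction q) (simp_all add: mult.assoc)

lemma sum_lessThan_add:
  fixes h :: "nat \<Rightarrow> 'a::comm_monoid_add"
  shows "(\<Sum>i<a + q. h i) = (\<Sum>i<a. h i) + (\<Sum>k<q. h (a + k))"
  by (induction q) (simp_all add: add.assoc)

definition append_family :: "nat \<Rightarrow> (nat \<Rightarrow> 'a) \<Rightarrow> (nat \<Rightarrow> 'a) \<Rightarrow> nat \<Rightarrow> 'a" where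
  "append_family k v w i = (if i < k then v i else w (i - k))"

text \<open>
  For alternating \<open>f\<close> and \<open>g\<close> of degrees \<open>a\<close> and \<open>q\<close> this is, up to a
  constant factor, the coordinate at \<open>\<mu>\<close> of their exterior product. Since the sum itself
  antisymmetrizes, a plain product of \<open>q\<close> coordinate vectors can stand for their exterior
  product in the place of \<open>g\<close>.
\<close>

definition alt_product :: "nat \<Rightarrow> nat \<Rightarrow> ((nat \<Rightarrow> nat) \<Rightarrow> real) \<Rightarrow> ((nat \<Rightarrow> nat) \<Rightarrow> real) \<Rightarrow> (nat \<Rightarrow> nat) \<Rightarrow> real" where
  "alt_product a q f g \<mu> =
    (\<Sum>\<pi> | \<pi> permutes {..<a + q}. of_int (sign \<pi>) * (f (\<mu> \<circ> \<pi>) * g (\<lambda>k. \<mu> (\<pi> (a + k)))))"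

lemma alt_product_sum_left:
  "alt_product a q (\<lambda>\<sigma>. \<Sum>i\<in>I. z i * f i \<sigma>) g \<mu> = (\<Sum>i\<in>I. z i * alt_product a q (f i) g \<mu>)"
  unfolding alt_product_def sum_distrib_left sum_distrib_right
  by (subst sum.swap) (simp add: mult_ac)

lemma alt_product_sum_right:
  "alt_product a q f (\<lambda>\<tau>. \<Sum>i\<in>I. z i * g i \<tau>) \<mu> = (\<Sum>i\<in>I. z i * alt_product a q f (g i) \<mu>)"
  unfolding alt_product_def sum_distrib_left sum_distrib_right
  by (subst sum.swap) (simp add: mult_ac)

text \<open>
  Expanding the minor by rows gives a double sum over \<open>\<tau>\<close> and \<open>\<pi>\<close>. For fixed
  \<open>\<tau>\<close>, extended by the identity to the last \<open>q\<close> rows, the substitution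
  \<open>\<pi> \<mapsto> \<pi> \<circ> \<tau>\<close> cancels both \<open>\<tau>\<close> and its sign and leaves
  the Leibniz formula for the large determinant. So each of the \<open>a!\<close> choices of \<open>\<tau>\<close>
  contributes the same value.
\<close>

lemma alt_product_minor_simple:
  "alt_product a q (minor a v) (\<lambda>\<tau>. \<Prod>k<q. u k (\<tau> k)) \<mu>
    = fact a * minor (a + q) (append_family a v u) \<mu>"
proof -
  let ?w = "append_family a v u"
  have term_eq: "(\<Prod>i<a. v (\<tau> i) (\<mu> (\<pi> i))) * (\<Prod>k<q. u k (\<mu> (\<pi> (a + k))))
      = (\<Prod>i<a + q. ?w (\<tau> i) (\<mu> (\<pi> i)))" if \<tau>: "\<tau> permutes {..<a}" for \<tau> \<pi>
  proof -
    have "?w (\<tau> i) = v (\<tau> i)" if "i < a" for i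
      using permutes_in_image[OF \<tau>, of i] that by (simp add: append_family_def)
    moreover have "?w (\<tau> (a + k)) = u k" for k
      using permutes_not_in[OF \<tau>, of "a + k"] by (simp add: append_family_def)
    ultimately show ?thesis
      by (simp add: prod_lessThan_add)
  qed
  have inner: "(\<Sum>\<pi> | \<pi> permutes {..<a + q}.
      of_int (sign \<pi>) * (of_int (sign \<tau>) * (\<Prod>i<a + q. ?w (\<tau> i) (\<mu> (\<pi> i))))) = minor (a + q) ?w \<mu>"
    if \<tau>: "\<tau> permutes {..<a}" for \<tau>
  proof -
    have \<tau>': "\<tau> permutes {..<a + q}"
      by (rule permutes_subset[OF \<tau>]) auto
    have "(\<Sum>\<pi> | \<pi> permutes {..<a + q}.
          of_int (sign \<pi>) * (of_int (sign \<tau>) * (\<Prod>i<a + q. ?w (\<tau> i) (\<mu> (\<pi> i)))))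
        = (\<Sum>\<pi> | \<pi> permutes {..<a + q}.
          of_int (sign (\<pi> \<circ> \<tau>)) * (of_int (sign \<tau>) * (\<Prod>i<a + q. ?w (\<tau> i) (\<mu> ((\<pi> \<circ> \<tau>) i)))))"
      by (rule sum_permutations_compose_right[OF \<tau>'])
    also have "\<dots> = (\<Sum>\<pi> | \<pi> permutes {..<a + q}. of_int (sign \<pi>) * (\<Prod>i<a + q. ?w i (\<mu> (\<pi> i))))"
    proof (intro sum.cong refl)
      fix \<pi> assume "\<pi> \<in> {\<pi>. \<pi> permutes {..<a + q}}"
      then have "permutation \<pi>" "permutation \<tau>"
        using \<tau> by (auto simp: permutation_permutes)
      then have "sign (\<pi> \<circ> \<tau>) * sign \<tau> = sign \<pi>"
        by (simp add: sign_compose)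
      then have "(of_int (sign (\<pi> \<circ> \<tau>)) * of_int (sign \<tau>) :: real) = of_int (sign \<pi>)"
        by (metis of_int_mult)
      moreover have "(\<Prod>i<a + q. ?w (\<tau> i) (\<mu> ((\<pi> \<circ> \<tau>) i))) = (\<Prod>i<a + q. ?w i (\<mu> (\<pi> i)))"
        using prod.permute[OF \<tau>', of "\<lambda>i. ?w i (\<mu> (\<pi> i))"] by (simp add: o_def)
      ultimately show "of_int (sign (\<pi> \<circ> \<tau>)) * (of_int (sign \<tau>) * (\<Prod>i<a + q. ?w (\<tau> i) (\<mu> ((\<pi> \<circ> \<tau>) i))))
          = of_int (sign \<pi>) * (\<Prod>i<a + q. ?w i (\<mu> (\<pi> i)))"
        by (simp add: mult.assoc[symmetric])
    qed
    finally show ?thesis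
      by (simp add: minor_def)
  qed
  have "alt_product a q (minor a v) (\<lambda>\<tau>. \<Prod>k<q. u k (\<tau> k)) \<mu>
      = (\<Sum>\<pi> | \<pi> permutes {..<a + q}. \<Sum>\<tau> | \<tau> permutes {..<a}.
          of_int (sign \<pi>) * (of_int (sign \<tau>) *
            ((\<Prod>i<a. v (\<tau> i) (\<mu> (\<pi> i))) * (\<Prod>k<q. u k (\<mu> (\<pi> (a + k)))))))"
    by (simp add: alt_product_def minor_expand_rows sum_distrib_left sum_distrib_right mult.assoc)
  also have "\<dots> = (\<Sum>\<tau> | \<tau> permutes {..<a}. \<Sum>\<pi> | \<pi> permutes {..<a + q}.
          of_int (sign \<pi>) * (of_int (sign \<tau>) * (\<Prod>i<a + q. ?w (\<tau> i) (\<mu> (\<pi> i)))))"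
    by (subst sum.swap) (intro sum.cong refl, simp add: term_eq)
  also have "\<dots> = (\<Sum>\<tau> | \<tau> permutes {..<a}. minor (a + q) ?w \<mu>)"
    by (intro sum.cong refl) (simp add: inner)
  also have "\<dots> = fact a * minor (a + q) ?w \<mu>"
    by (simp add: card_permutations)
  finally show ?thesis .
qed

text \<open>
  Up to sign, the interior product of \<open>g\<close> with the basis multi-covector of the frozen indices
  \<open>\<rho> q, \<rho> (q + 1), \<dots>\<close>.
\<close>

definition contract :: "nat \<Rightarrow> (nat \<Rightarrow> nat) \<Rightarrow> ((nat \<Rightarrow> nat) \<Rightarrow> real) \<Rightarrow> (nat \<Rightarrow> nat) \<Rightarrow> real" where
  "contract q \<rho> g \<tau> = g (\<lambda>k. if k < q then \<tau> k else \<rho> k)"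

lemma contract_minor:
  assumes "q \<le> a"
  shows "contract q \<rho> (minor a w) = (\<lambda>\<tau>. \<Sum>\<theta> | \<theta> permutes {..<a}.
    (of_int (sign \<theta>) * (\<Prod>k = q..<a. w (\<theta> k) (\<rho> k))) * (\<Prod>k<q. w (\<theta> k) (\<tau> k)))"
proof
  fix \<tau>
  have "(\<Prod>k<a. w (\<theta> k) (if k < q then \<tau> k else \<rho> k))
      = (\<Prod>k<q. w (\<theta> k) (\<tau> k)) * (\<Prod>k = q..<a. w (\<theta> k) (\<rho> k))" for \<theta>
    using assms prod.atLeastLessThan_concat[of 0 q a "\<lambda>k. w (\<theta> k) (if k < q then \<tau> k else \<rho> k)"]
    by (simp add: lessThan_atLeast0)
  then show "contract q \<rho> (minor a w) \<tau> = (\<Sum>\<theta> | \<theta> permutes {..<a}.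
      (of_int (sign \<theta>) * (\<Prod>k = q..<a. w (\<theta> k) (\<rho> k))) * (\<Prod>k<q. w (\<theta> k) (\<tau> k)))"
    by (simp add: contract_def minor_expand_rows mult_ac)
qed

text \<open>
  The contraction of \<open>w 0 \<and> \<dots> \<and> w (a - 1)\<close> is a linear combination of products of
  \<open>q\<close> of the vectors \<open>w k\<close>, and the product of \<open>v 0 \<and> \<dots> \<and> v (a - 1)\<close>
  with each of them is a determinant whose rows are \<open>v\<close> followed by those vectors.
\<close>

lemma alt_product_contract_eq_0:
  assumes "q \<le> a"
    and "\<And>\<theta>. \<theta> permutes {..<a} \<Longrightarrow> minor (a + q) (append_family a v (\<lambda>k. w (\<theta> k))) \<mu> = 0"
  shows "alt_product a q (minor a v) (contract q \<rho> (minor a w)) \<mu> = 0"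
  unfolding contract_minor[OF assms(1)] alt_product_sum_right
  using alt_product_minor_simple[of a q v "\<lambda>k. w (\<theta> k)" \<mu> for \<theta>]
  by (intro sum.neutral) (simp add: assms(2))

section \<open>Leading sets\<close>

definition support :: "nat \<Rightarrow> nat \<Rightarrow> ((nat \<Rightarrow> nat) \<Rightarrow> real) \<Rightarrow> nat set set" where
  "support n k f = {\<sigma> ` {..<k} | \<sigma>. \<sigma> ` {..<k} \<subseteq> {..<n} \<and> f \<sigma> \<noteq> 0}"

text \<open>
  Sets are ordered by \<open>set_encode S = (\<Sum>s\<in>S. 2 ^ s)\<close>. This order is total because the encoding is
  injective on finite sets, and it is compatible with products because the encoding is additive on
  disjoint unions.
\<close>

definition leading :: "nat \<Rightarrow> nat \<Rightarrow> ((nat \<Rightarrow> nat) \<Rightarrow> real) \<Rightarrow> nat set \<Rightarrow> bool" where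
  "leading n k f S \<longleftrightarrow> S \<in> support n k f \<and> (\<forall>S'\<in>support n k f. set_encode S' \<le> set_encode S)"

lemma leading_exists:
  assumes "support n k f \<noteq> {}"
  shows "\<exists>S. leading n k f S"
proof -
  have "finite (support n k f)"
    by (rule finite_subset[of _ "Pow {..<n}"]) (auto simp: support_def)
  then have "Max (set_encode ` support n k f) \<in> set_encode ` support n k f"
    using assms by (intro Max_in) auto
  then show ?thesis
    using \<open>finite (support n k f)\<close> unfolding leading_def by (metis Max_ge finite_imageI image_eqI imageE)
qed

lemma support_card:
  assumes "alternating k f" "S \<in> support n k f"
  shows "S \<subseteq> {..<n}" "finite S" "card S = k"
proof -
  obtain \<sigma> where \<sigma>: "S = \<sigma> ` {..<k}" "S \<subseteq> {..<n}" "f \<sigma> \<noteq> 0"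
    using assms(2) unfolding support_def by blast
  then show "S \<subseteq> {..<n}" "finite S"
    by auto
  show "card S = k"
    unfolding \<sigma>(1) by (simp add: card_image alternating_inj_on[OF assms(1) \<sigma>(3)])
qed

lemma alternating_nonzero_on_support:
  assumes "alternating k f" "\<sigma> ` {..<k} \<in> support n k f"
  shows "f \<sigma> \<noteq> 0"
  using assms alternating_same_image unfolding support_def by fastforce

text \<open>
  This is the multiplicativity of leading terms. Choose \<open>R\<close> with
  \<open>S \<inter> T \<subseteq> R \<subseteq> T\<close> and \<open>card R = t - 1\<close>; then \<open>S\<close> and
  \<open>T - R\<close> are disjoint. Contract \<open>g\<close> by \<open>R\<close>, and let \<open>\<mu>\<close> list
  \<open>S\<close> followed by \<open>T - R\<close>. A nonzero summand of the product splits the entries of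
  \<open>\<mu>\<close> into a set \<open>S'\<close> of the support of \<open>f\<close> and a set \<open>T' - R\<close> with
  \<open>T'\<close> in the support of \<open>g\<close>. The weights of \<open>S'\<close> and \<open>T'\<close> add up to
  those of \<open>S\<close> and \<open>T\<close>, so by maximality \<open>S' = S\<close> and \<open>T' = T\<close>. The
  permutation therefore preserves both blocks, its sign is compensated by the alternation of
  \<open>f\<close> and \<open>g\<close>, and all nonzero summands are equal: no cancellation is possible.
\<close>

lemma alt_product_contract_leading_nonzero:
  assumes f: "alternating a f" and g: "alternating a g"
    and S: "leading n a f S" and T: "leading n a g T"
    and "card (S \<inter> T) < t" "t \<le> a"
  shows "\<exists>\<mu> \<rho>. alt_product a (Suc a - t) f (contract (Suc a - t) \<rho> g) \<mu> \<noteq> 0"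
proof -
  define q where "q = Suc a - t"
  have q: "q \<le> a" "a - q = t - 1"
    using assms(5,6) by (auto simp: q_def)
  have Ss: "S \<in> support n a f" and Ts: "T \<in> support n a g"
    using S T by (auto simp: leading_def)
  note cS = support_card[OF f Ss] and cT = support_card[OF g Ts]
  obtain R where R: "S \<inter> T \<subseteq> R" "R \<subseteq> T" "card R = t - 1"
    using exists_subset_between[of "S \<inter> T" "t - 1" T] cT assms(5,6) by fastforce
  have finR: "finite R"
    using R(2) cT(2) finite_subset by blast
  have "card (T - R) = q"
    using R cT finR assms(5,6) by (simp add: card_Diff_subset q_def)
  then obtain d where d: "bij_betw d {..<q} (T - R)"
    using ex_bij_betw_nat_finite[of "T - R"] cT(2) by (auto simp: lessThan_atLeast0)
  obtain s where s: "bij_betw s {..<a} S"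
    using ex_bij_betw_nat_finite[of S] cS by (auto simp: lessThan_atLeast0)
  have "bij_betw (\<lambda>k. k - q) {q..<a} {..<t - 1}"
    by (rule bij_betwI[where g = "\<lambda>k. k + q"]) (use q in auto)
  moreover obtain r where "bij_betw r {..<t - 1} R"
    using ex_bij_betw_nat_finite[OF finR] R(3) by (auto simp: lessThan_atLeast0)
  ultimately have "bij_betw (r \<circ> (\<lambda>k. k - q)) {q..<a} R"
    by (rule bij_betw_trans)
  then obtain \<rho> where \<rho>: "bij_betw \<rho> {q..<a} R"
    by blast
  define \<mu> where "\<mu> k = (if k < a then s k else d (k - a))" for k
  \<comment> \<open>Both factors as one function of the whole tuple, so that permutations of its two blocks can act.\<close>
  define F where "F x = f x * contract q \<rho> g (\<lambda>k. x (a + k))" for x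
  have \<mu>S: "\<mu> ` {..<a} = S"
    using s by (auto simp: \<mu>_def bij_betw_def image_def)
  have \<mu>T: "(\<lambda>k. \<mu> (a + k)) ` {..<q} = T - R"
    using d by (auto simp: \<mu>_def bij_betw_def)
  have split: "{..<a + q} = {..<a} \<union> {a..<a + q}" "{a..<a + q} = (\<lambda>k. a + k) ` {..<q}"
    by (auto simp: image_iff Bex_def) presburger
  have \<mu>T': "\<mu> ` {a..<a + q} = T - R"
    unfolding split(2) image_image by (rule \<mu>T)
  have ST: "S \<inter> (T - R) = {}"
    using R(1) by blast
  have \<mu>_inj: "inj_on \<mu> {..<a + q}"
  proof (rule eq_card_imp_inj_on)
    have "\<mu> ` {..<a + q} = S \<union> (T - R)"
      unfolding split(1) image_Un \<mu>S \<mu>T' ..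
    then show "card (\<mu> ` {..<a + q}) = card {..<a + q}"
      using ST cS cT \<open>card (T - R) = q\<close> by (simp add: card_Un_disjoint)
  qed simp
  have img_g: "(\<lambda>k. if k < q then x k else \<rho> k) ` {..<a} = x ` {..<q} \<union> R" for x :: "nat \<Rightarrow> nat"
  proof -
    have "{..<a} \<inter> {k. k < q} = {..<q}" "{..<a} \<inter> {k. \<not> k < q} = {q..<a}"
      using q by auto
    then show ?thesis
      using \<rho> by (simp add: bij_betw_def)
  qed
  have F\<mu>: "F \<mu> \<noteq> 0"
  proof -
    have "f \<mu> \<noteq> 0"
      using alternating_nonzero_on_support[OF f, of \<mu> n] \<mu>S Ss by simp
    moreover have "g (\<lambda>k. if k < q then \<mu> (a + k) else \<rho> k) \<noteq> 0"
    proof (rule alternating_nonzero_on_support[OF g, of _ n])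
      have "(\<lambda>k. if k < q then \<mu> (a + k) else \<rho> k) ` {..<a} = T"
        using img_g[of "\<lambda>k. \<mu> (a + k)"] \<mu>T R(2) by auto
      then show "(\<lambda>k. if k < q then \<mu> (a + k) else \<rho> k) ` {..<a} \<in> support n a g"
        using Ts by simp
    qed
    ultimately show ?thesis
      by (simp add: F_def contract_def)
  qed
  have term_eq: "of_int (sign \<pi>) * F (\<mu> \<circ> \<pi>) = F \<mu>"
    if \<pi>: "\<pi> permutes {..<a + q}" and nz: "F (\<mu> \<circ> \<pi>) \<noteq> 0" for \<pi>
  proof -
    define y where "y k = (if k < q then \<mu> (\<pi> (a + k)) else \<rho> k)" for k
    have "f (\<mu> \<circ> \<pi>) \<noteq> 0" "g y \<noteq> 0"
      using nz by (auto simp: F_def contract_def y_def[abs_def])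
    have \<mu>n: "\<mu> k < n" if "k < a + q" for k
      using that \<mu>S \<mu>T' cS(1) cT(1) split by blast
    have \<pi>n: "\<pi> k < a + q \<longleftrightarrow> k < a + q" for k
      using permutes_in_image[OF \<pi>, of k] by simp
    define S' where "S' = (\<mu> \<circ> \<pi>) ` {..<a}"
    define T' where "T' = y ` {..<a}"
    have "\<mu> (\<pi> k) < n" if "k < a + q" for k
      using \<mu>n \<pi>n that by simp
    then have \<mu>\<pi>: "S' \<subseteq> {..<n}" "(\<lambda>k. \<mu> (\<pi> (a + k))) ` {..<q} \<subseteq> {..<n}"
      by (auto simp: S'_def)
    then have S': "S' \<in> support n a f"
      unfolding support_def S'_def using \<open>f (\<mu> \<circ> \<pi>) \<noteq> 0\<close> by blast
    have "T' = (\<lambda>k. \<mu> (\<pi> (a + k))) ` {..<q} \<union> R"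
      unfolding T'_def y_def by (rule img_g)
    then have "T' \<subseteq> {..<n}"
      using \<mu>\<pi>(2) R(2) cT(1) by blast
    then have T': "T' \<in> support n a g"
      unfolding support_def T'_def using \<open>g y \<noteq> 0\<close> by blast
    have inj_S': "inj_on (\<mu> \<circ> \<pi>) {..<a}" and inj_T': "inj_on y {..<a}"
      using alternating_inj_on[of a f "\<mu> \<circ> \<pi>"] alternating_inj_on[of a g y] f g
        \<open>f (\<mu> \<circ> \<pi>) \<noteq> 0\<close> \<open>g y \<noteq> 0\<close> by simp_all
    have encS': "set_encode S' = (\<Sum>k<a. 2 ^ \<mu> (\<pi> k))"
      unfolding set_encode_def S'_def sum.reindex[OF inj_S']
      by (simp only: o_def)
    have encS: "set_encode S = (\<Sum>k<a. 2 ^ \<mu> k)"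
      unfolding set_encode_def \<mu>S[symmetric]
      by (subst sum.reindex) (auto simp: o_def intro: inj_on_subset[OF \<mu>_inj])
    have \<rho>sum: "(\<Sum>k = q..<a. 2 ^ \<rho> k) = set_encode R"
      unfolding set_encode_def using sum.reindex_bij_betw[OF \<rho>, of "(^) (2::nat)"] by simp
    have "set_encode T' = (\<Sum>k<a. 2 ^ y k)"
      unfolding set_encode_def T'_def sum.reindex[OF inj_T']
      by (simp only: o_def)
    also have "\<dots> = (\<Sum>k<q. 2 ^ \<mu> (\<pi> (a + k))) + (\<Sum>k = q..<a. 2 ^ \<rho> k)"
      using q sum.atLeastLessThan_concat[of 0 q a "\<lambda>k. 2 ^ y k :: nat"]
      by (simp add: y_def lessThan_atLeast0)
    finally have encT': "set_encode T' = (\<Sum>k<q. 2 ^ \<mu> (\<pi> (a + k))) + set_encode R"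
      by (simp add: \<rho>sum)
    have "(\<Sum>k<q. 2 ^ \<mu> (a + k)) = (set_encode (T - R) :: nat)"
      unfolding set_encode_def \<mu>_def using sum.reindex_bij_betw[OF d, of "(^) (2::nat)"] by simp
    moreover have "set_encode T = set_encode (T - R) + set_encode R"
      unfolding set_encode_def using R(2) cT(2) by (rule sum.subset_diff)
    ultimately have encT: "set_encode T = (\<Sum>k<q. 2 ^ \<mu> (a + k)) + set_encode R"
      by simp
    have "(\<Sum>k<a + q. 2 ^ \<mu> (\<pi> k) :: nat) = (\<Sum>k<a + q. 2 ^ \<mu> k)"
      using sum.permute[OF \<pi>, of "\<lambda>k. 2 ^ \<mu> k :: nat"] by (simp only: o_def)
    then have "set_encode S' + set_encode T' = set_encode S + set_encode T"
      unfolding encS' encT' encS encT by (simp add: sum_lessThan_add)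
    moreover have "set_encode S' \<le> set_encode S" "set_encode T' \<le> set_encode T"
      using S T S' T' by (auto simp: leading_def)
    ultimately have "set_encode S' = set_encode S"
      by linarith
    then have "S' = S"
      using support_card(2)[OF f S'] cS(2) by (simp add: set_encode_eq)
    have \<pi>a: "\<pi> k < a" if "k < a" for k
    proof -
      have "\<mu> (\<pi> k) \<in> \<mu> ` {..<a}"
        using that \<open>S' = S\<close> \<mu>S by (auto simp: S'_def)
      then obtain l where "l < a" "\<mu> (\<pi> k) = \<mu> l"
        by auto
      then show ?thesis
        using inj_onD[OF \<mu>_inj, of "\<pi> k" l] \<pi>n[of k] that by simp
    qed
    have inj: "inj \<pi>"
      using \<pi> by (rule permutes_inj)
    \<comment> \<open>The alternation of \<open>f\<close> accounts for \<open>p1\<close>, that of \<open>g\<close> for \<open>p2\<close>.\<close>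
    define p1 where "p1 k = (if k < a then \<pi> k else k)" for k
    define p2 where "p2 k = (if k < a then k else \<pi> k)" for k
    have bij1: "bij_betw \<pi> {..<a} {..<a}"
      using \<pi>a by (intro bij_betw_imageI endo_inj_surj inj_on_subset[OF inj]) auto
    have "\<pi> ` ({..<a + q} - {..<a}) = {..<a + q} - {..<a}"
      unfolding image_set_diff[OF inj]
      by (simp only: permutes_image[OF \<pi>] bij_betw_imp_surj_on[OF bij1])
    moreover have "{..<a + q} - {..<a} = {a..<a + q}"
      by auto
    ultimately have bij2: "bij_betw \<pi> {a..<a + q} {a..<a + q}"
      by (intro bij_betw_imageI inj_on_subset[OF inj]) auto
    have p1: "p1 permutes {..<a}"
    proof (rule bij_imp_permutes)
      show "bij_betw p1 {..<a} {..<a}"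
        using bij1 by (subst bij_betw_cong[where g = \<pi>]) (simp_all add: p1_def)
    qed (simp add: p1_def)
    have p2: "p2 permutes {a..<a + q}"
    proof (rule bij_imp_permutes)
      show "bij_betw p2 {a..<a + q} {a..<a + q}"
        using bij2 by (subst bij_betw_cong[where g = \<pi>]) (simp_all add: p2_def)
      show "p2 k = k" if "k \<notin> {a..<a + q}" for k
        using that permutes_not_in[OF \<pi>, of k] by (auto simp: p2_def)
    qed
    have "\<pi> = p1 \<circ> p2"
    proof
      fix k
      show "\<pi> k = (p1 \<circ> p2) k"
      proof (cases "k < a")
        case False
        have "\<not> \<pi> k < a"
        proof
          assume "\<pi> k < a"
          then have "\<pi> k \<in> \<pi> ` {..<a}"
            using bij1 by (simp add: bij_betw_def)
          then obtain l where "l < a" "\<pi> l = \<pi> k"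
            by auto
          then show False
            using inj False by (auto dest: injD)
        qed
        then show ?thesis
          using False by (simp add: p1_def p2_def)
      qed (simp add: p1_def p2_def)
    qed
    have F1: "F (x \<circ> p1) = of_int (sign p1) * F x" for x
    proof (rule sign_of_transposition_antisymmetric[OF _ _ p1])
      fix x i j assume ij: "i \<in> {..<a}" "j \<in> {..<a}" "i \<noteq> (j::nat)"
      have "f (x \<circ> Transposition.transpose i j) = - f x"
        using f ij unfolding alternating_def by blast
      moreover have "(x \<circ> Transposition.transpose i j) (a + k) = x (a + k)" for k
        using ij by (simp add: Transposition.transpose_def)
      ultimately show "F (x \<circ> Transposition.transpose i j) = - F x"
        by (simp add: F_def)
    qed simp
    have F2: "F (x \<circ> p2) = of_int (sign p2) * F x" for x
    proof (rule sign_of_transposition_antisymmetric[OF _ _ p2])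
      fix x i j assume ij: "i \<in> {a..<a + q}" "j \<in> {a..<a + q}" "i \<noteq> (j::nat)"
      have "f (x \<circ> Transposition.transpose i j) = f x"
        by (rule alternating_cong[OF f]) (use ij in \<open>auto simp: Transposition.transpose_def\<close>)
      moreover have "contract q \<rho> g (\<lambda>k. (x \<circ> Transposition.transpose i j) (a + k))
          = - contract q \<rho> g (\<lambda>k. x (a + k))"
      proof -
        define y where "y k = (if k < q then x (a + k) else \<rho> k)" for k
        have gy: "g (y \<circ> Transposition.transpose (i - a) (j - a)) = - g y"
          using g ij q unfolding alternating_def by auto
        have "(y \<circ> Transposition.transpose (i - a) (j - a)) k
            = (if k < q then (x \<circ> Transposition.transpose i j) (a + k) else \<rho> k)" for k
          using ij by (auto simp: y_def Transposition.transpose_def)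
        then have "y \<circ> Transposition.transpose (i - a) (j - a)
            = (\<lambda>k. if k < q then (x \<circ> Transposition.transpose i j) (a + k) else \<rho> k)"
          by (rule ext)
        with gy show ?thesis
          unfolding contract_def y_def[abs_def] by simp
      qed
      ultimately show "F (x \<circ> Transposition.transpose i j) = - F x"
        by (simp add: F_def)
    qed simp
    have "F (\<mu> \<circ> \<pi>) = of_int (sign p2) * (of_int (sign p1) * F \<mu>)"
      unfolding \<open>\<pi> = p1 \<circ> p2\<close> o_assoc F2 F1 ..
    moreover have "sign \<pi> = sign p1 * sign p2"
      unfolding \<open>\<pi> = p1 \<circ> p2\<close>
      using p1 p2 by (intro sign_compose) (auto simp: permutation_permutes)
    ultimately show ?thesis
      by (simp add: sign_def)
  qed
  define N where "N = card {\<pi>. \<pi> permutes {..<a + q} \<and> F (\<mu> \<circ> \<pi>) \<noteq> 0}"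
  have fin: "finite {\<pi>. \<pi> permutes {..<a + q}}"
    by (simp add: finite_permutations)
  have "alt_product a q f (contract q \<rho> g) \<mu>
      = (\<Sum>\<pi> | \<pi> permutes {..<a + q}. of_int (sign \<pi>) * F (\<mu> \<circ> \<pi>))"
    by (simp add: alt_product_def F_def)
  also have "\<dots> = (\<Sum>\<pi> | \<pi> permutes {..<a + q} \<and> F (\<mu> \<circ> \<pi>) \<noteq> 0. F \<mu>)"
    by (rule sum.mono_neutral_cong_right) (auto simp: fin term_eq)
  also have "\<dots> = of_nat N * F \<mu>"
    by (simp add: N_def)
  finally have "alt_product a q f (contract q \<rho> g) \<mu> = of_nat N * F \<mu>" .
  moreover have "N \<noteq> 0"
  proof -
    have "finite {\<pi>. \<pi> permutes {..<a + q} \<and> F (\<mu> \<circ> \<pi>) \<noteq> 0}"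
      by (rule finite_subset[OF _ fin]) auto
    moreover have "id \<in> {\<pi>. \<pi> permutes {..<a + q} \<and> F (\<mu> \<circ> \<pi>) \<noteq> 0}"
      using F\<mu> by simp
    ultimately show ?thesis
      unfolding N_def card_eq_0_iff by blast
  qed
  ultimately have "alt_product a q f (contract q \<rho> g) \<mu> \<noteq> 0"
    using F\<mu> by simp
  then show ?thesis
    unfolding q_def by blast
qed

section \<open>Functionals in general position\<close>

text \<open>
  To treat one more vector \<open>y\<close>, add \<open>\<epsilon> * g\<close> with \<open>g y = 1\<close>; each vector
  excludes at most one value of \<open>\<epsilon>\<close> besides \<open>0\<close>, and the field is infinite.
\<close>

lemma linear_functional_nonzero_on_finite:
  fixes X :: "'v::real_vector set"
  assumes "finite X" "0 \<notin> X"
  shows "\<exists>f :: 'v \<Rightarrow> real. linear f \<and> (\<forall>x\<in>X. f x \<noteq> 0)"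
  using assms
proof (induction X)
  case empty
  then show ?case
    by (auto intro: linear_zero)
next
  case (insert y X)
  then obtain f :: "'v \<Rightarrow> real" where f: "linear f" "\<forall>x\<in>X. f x \<noteq> 0"
    by auto
  have "independent {y}"
    using insert.prems by (auto simp: dependent_single)
  then obtain g :: "'v \<Rightarrow> real" where g: "linear g" "g y = 1"
    using linear_independent_extend[of "{y}" "\<lambda>_. 1 :: real"] by auto
  obtain \<epsilon> :: real where \<epsilon>: "\<epsilon> \<notin> (\<lambda>x. - f x / g x) ` insert y X \<union> {0}"
    using ex_new_if_finite[OF infinite_UNIV_char_0, of "(\<lambda>x. - f x / g x) ` insert y X \<union> {0}"] insert.hyps
    by blast
  have "f x + \<epsilon> * g x \<noteq> 0" if "x \<in> insert y X" for x
  proof (cases "g x = 0")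
    case True
    then show ?thesis
      using that f(2) g(2) by auto
  next
    case False
    then have "\<epsilon> \<noteq> - f x / g x"
      using \<epsilon> that by blast
    then show ?thesis
      using False by (auto simp: field_simps)
  qed
  moreover have "linear (\<lambda>x. f x + \<epsilon> * g x)"
    using f(1) g(1) linear_compose_add[OF f(1), of "\<lambda>x. \<epsilon> *\<^sub>R g x"] linear_compose_scale_right[OF g(1), of \<epsilon>]
    by simp
  ultimately show ?case
    by blast
qed

text \<open>
  A projection of \<open>V\<close> to an \<open>n\<close>-dimensional space that is injective on finitely many
  given subspaces of dimension at most \<open>n\<close>. The first coordinate \<open>f\<close> is chosen so that it
  does not vanish identically on any nonzero space \<open>span (E i)\<close>. Its kernel there is generated by fewer
  vectors, namely by those of \<open>E i\<close> other than a fixed \<open>e i\<close> with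
  \<open>f (e i) \<noteq> 0\<close>, each projected along \<open>e i\<close> to the kernel; the induction hypothesis
  supplies the other coordinates.
\<close>

lemma generic_functionals:
  fixes E :: "'i \<Rightarrow> 'v::real_vector set"
  assumes "finite I" "\<And>i. i \<in> I \<Longrightarrow> finite (E i) \<and> card (E i) \<le> n"
  shows "\<exists>\<phi> :: nat \<Rightarrow> 'v \<Rightarrow> real. (\<forall>c. linear (\<phi> c)) \<and>
    (\<forall>i\<in>I. \<forall>u\<in>span (E i). (\<forall>c<n. \<phi> c u = 0) \<longrightarrow> u = 0)"
  using assms(2)
proof (induction n arbitrary: E)
  case 0
  then have "E i = {}" if "i \<in> I" for i
    using that by fastforce
  then show ?case
    by (intro exI[of _ "\<lambda>_ _. 0"]) (auto intro: linear_zero)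
next
  case (Suc n)
  define e where "e i = (SOME x. x \<in> E i \<and> x \<noteq> 0)" for i
  define J where "J = {i\<in>I. \<not> E i \<subseteq> {0}}"
  have e: "e i \<in> E i" "e i \<noteq> 0" if "i \<in> J" for i
    using that someI_ex[of "\<lambda>x. x \<in> E i \<and> x \<noteq> 0"] by (auto simp: J_def e_def)
  have "finite (e ` J)" "0 \<notin> e ` J"
    using assms(1) e(2) by (simp add: J_def, force)
  then obtain f :: "'v \<Rightarrow> real" where f: "linear f" "\<forall>x\<in>e ` J. f x \<noteq> 0"
    using linear_functional_nonzero_on_finite by blast
  define r where "r i u = u - (f u / f (e i)) *\<^sub>R e i" for i u
  define E' where "E' i = (if i \<in> J then r i ` (E i - {e i}) else {})" for i
  have "finite (E' i) \<and> card (E' i) \<le> n" if "i \<in> I" for i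
  proof (cases "i \<in> J")
    case True
    have "card (E' i) \<le> card (E i - {e i})"
      using Suc.prems[OF that] True by (simp add: E'_def card_image_le)
    also have "\<dots> \<le> n"
      using Suc.prems[OF that] e(1)[OF True] by auto
    finally show ?thesis
      using Suc.prems[OF that] by (simp add: E'_def)
  qed (simp add: E'_def)
  then have "\<exists>\<phi> :: nat \<Rightarrow> 'v \<Rightarrow> real. (\<forall>c. linear (\<phi> c)) \<and>
      (\<forall>i\<in>I. \<forall>u\<in>span (E' i). (\<forall>c<n. \<phi> c u = 0) \<longrightarrow> u = 0)"
    by (rule Suc.IH)
  then obtain \<phi> :: "nat \<Rightarrow> 'v \<Rightarrow> real" where \<phi>: "\<forall>c. linear (\<phi> c)"
    "\<forall>i\<in>I. \<forall>u\<in>span (E' i). (\<forall>c<n. \<phi> c u = 0) \<longrightarrow> u = 0"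
    by (elim exE conjE)
  define \<psi> where "\<psi> c = (case c of 0 \<Rightarrow> f | Suc c' \<Rightarrow> \<phi> c')" for c
  have "u = 0" if i: "i \<in> I" and u: "u \<in> span (E i)" and zero: "\<forall>c<Suc n. \<psi> c u = 0" for i u
  proof (cases "i \<in> J")
    case False
    then have "span (E i) \<subseteq> {0}"
      using i span_mono[of "E i" "{0}"] by (auto simp: J_def)
    then show ?thesis
      using u by blast
  next
    case True
    have "r i u \<in> span (E' i)"
      using u
    proof (induction rule: span_induct_alt)
      case base
      then show ?case
        by (simp add: r_def linear_0[OF f(1)] span_zero)
    next
      case (step c x y)
      have "r i x \<in> span (E' i)"
      proof (cases "x = e i")
        case True
        then have "r i x = 0"
          using f(2) \<open>i \<in> J\<close> by (simp add: r_def)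
        then show ?thesis
          by (simp add: span_zero)
      next
        case False
        then show ?thesis
          using step(1) \<open>i \<in> J\<close> by (auto simp: E'_def intro: span_base)
      qed
      moreover have "r i (c *\<^sub>R x + y) = c *\<^sub>R r i x + r i y"
        by (simp add: r_def linear_add[OF f(1)] linear_scale[OF f(1)] algebra_simps add_divide_distrib)
      ultimately show ?case
        using step(2) by (simp add: span_add span_scale)
    qed
    moreover have "f u = 0"
      using zero[rule_format, of 0] by (simp add: \<psi>_def)
    moreover have "\<phi> c u = 0" if "c < n" for c
      using zero[rule_format, of "Suc c"] that by (simp add: \<psi>_def)
    ultimately show ?thesis
      using \<phi>(2) i by (simp add: r_def)
  qed
  moreover have "\<forall>c. linear (\<psi> c)"
    using f(1) \<phi>(1) by (simp add: \<psi>_def split: nat.split)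
  ultimately show ?case
    by (intro exI[of _ \<psi>] conjI ballI impI)
qed

section \<open>Linear independence of finite families\<close>

text \<open>
  Independence of families rather than sets: the vectors are the rows of determinants, where order and
  repetition matter.
\<close>

definition indep_family :: "nat \<Rightarrow> (nat \<Rightarrow> 'v::real_vector) \<Rightarrow> bool" where
  "indep_family k e \<longleftrightarrow> (\<forall>z. (\<Sum>i<k. z i *\<^sub>R e i) = 0 \<longrightarrow> (\<forall>i<k. z i = 0))"

lemma indep_family_of_independent:
  assumes "independent C" "bij_betw e {..<k} C"
  shows "indep_family k e"
  unfolding indep_family_def
proof (intro allI impI)
  fix z i assume z: "(\<Sum>i<k. z i *\<^sub>R e i) = 0" and "i < k"
  have inj: "inj_on e {..<k}" and C: "e ` {..<k} = C"
    using assms(2) by (auto simp: bij_betw_def)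
  define z' where "z' x = z (inv_into {..<k} e x)" for x
  have "(\<Sum>x\<in>C. z' x *\<^sub>R x) = (\<Sum>i<k. z i *\<^sub>R e i)"
    unfolding C[symmetric] using inj by (simp add: sum.reindex z'_def)
  then have "z' (e i) = 0"
    using independentD[OF assms(1), of C z' "e i"] z C \<open>i < k\<close> bij_betw_finite[OF assms(2)] by auto
  then show "z i = 0"
    using inj \<open>i < k\<close> by (simp add: z'_def)
qed

lemma span_image_lessThan:
  assumes "x \<in> span (e ` {..<k::nat})"
  shows "\<exists>z. x = (\<Sum>i<k. z i *\<^sub>R e i)"
  using assms
proof (induction rule: span_induct_alt)
  case base
  then show ?case
    by (intro exI[of _ "\<lambda>_. 0"]) simp
next
  case (step c x y)
  then obtain z i where z: "y = (\<Sum>i<k. z i *\<^sub>R e i)" "i < k" "x = e i"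
    by blast
  have "(\<Sum>j<k. (if j = i then c else 0) *\<^sub>R e j) = (\<Sum>j<k. if j = i then c *\<^sub>R e j else 0)"
    by (rule sum.cong) auto
  then have "c *\<^sub>R x + y = (\<Sum>j<k. ((if j = i then c else 0) + z j) *\<^sub>R e j)"
    using z by (simp add: scaleR_add_left sum.distrib)
  then show ?case
    by (rule exI[of _ "\<lambda>j. (if j = i then c else 0) + z j"])
qed

lemma subspace_basis_family:
  fixes S :: "'v::real_vector set"
  assumes "subspace S" "dim S = k" "0 < k"
  shows "\<exists>e. indep_family k e \<and> (\<forall>i<k. e i \<in> S) \<and> S = span (e ` {..<k})"
proof -
  obtain C where C: "C \<subseteq> S" "independent C" "S \<subseteq> span C" "card C = k"
    using basis_exists[of S] assms(2) by blast
  then have "finite C"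
    using assms(3) by (intro card_ge_0_finite) simp
  then obtain e where e: "bij_betw e {..<k} C"
    using ex_bij_betw_nat_finite C(4) by (auto simp: lessThan_atLeast0)
  then have "e ` {..<k} = C"
    by (simp add: bij_betw_def)
  moreover have "S = span C"
    using C assms(1) by (intro equalityI span_minimal)
  ultimately show ?thesis
    using C(1) indep_family_of_independent[OF C(2) e] by blast
qed

lemma more_vectors_than_generators_dependent:
  assumes "\<And>i. i < k \<Longrightarrow> x i \<in> span (e ` {..<d})" "d < k"
  shows "\<not> indep_family k x"
proof -
  have "\<forall>i\<in>{..<k}. \<exists>M. x i = (\<Sum>l<d. M l *\<^sub>R e l)"
    using span_image_lessThan[OF assms(1)] by auto
  then obtain M where M: "\<forall>i\<in>{..<k}. x i = (\<Sum>l<d. M i l *\<^sub>R e l)"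
    by metis
  obtain z where z: "\<exists>i<k. z i \<noteq> 0" "\<forall>l\<in>{..<d}. (\<Sum>i<k. z i * M i l) = 0"
    using homogeneous_system_nontrivial[of "{..<d}" k M] assms(2) by auto
  have "(\<Sum>i<k. z i *\<^sub>R x i) = (\<Sum>i<k. \<Sum>l<d. (z i * M i l) *\<^sub>R e l)"
    using M by (simp add: scaleR_sum_right)
  also have "\<dots> = (\<Sum>l<d. (\<Sum>i<k. z i * M i l) *\<^sub>R e l)"
    by (subst sum.swap) (simp add: scaleR_sum_left)
  also have "\<dots> = 0"
    using z(2) by simp
  finally show ?thesis
    using z(1) unfolding indep_family_def by blast
qed

lemma sum_append_family:
  fixes v w :: "nat \<Rightarrow> 'v::real_vector"
  shows "(\<Sum>i<a + q. z i *\<^sub>R append_family a v w i)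
    = (\<Sum>i<a. z i *\<^sub>R v i) + (\<Sum>k<q. z (a + k) *\<^sub>R w k)"
  by (simp add: sum_lessThan_add append_family_def)

lemma indep_family_append:
  assumes v: "indep_family a v" and w: "indep_family q w"
    and "span (v ` {..<a}) \<inter> span (w ` {..<q}) \<subseteq> {0}"
  shows "indep_family (a + q) (append_family a v w)"
  unfolding indep_family_def
proof (intro allI impI)
  fix z i
  assume z: "(\<Sum>i<a + q. z i *\<^sub>R append_family a v w i) = 0" and i: "i < a + q"
  define x where "x = (\<Sum>i<a. z i *\<^sub>R v i)"
  have x: "x = - (\<Sum>k<q. z (a + k) *\<^sub>R w k)"
    using z by (simp add: sum_append_family x_def eq_neg_iff_add_eq_0)
  have "x \<in> span (v ` {..<a})"
    unfolding x_def by (intro span_sum span_scale span_base) auto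
  moreover have "x \<in> span (w ` {..<q})"
    unfolding x by (intro span_neg span_sum span_scale span_base) auto
  ultimately have "x = 0"
    using assms(3) by blast
  then have "\<forall>i<a. z i = 0" "\<forall>k<q. z (a + k) = 0"
    using v w x unfolding indep_family_def x_def by auto
  then show "z i = 0"
    using i by (metis le_add_diff_inverse less_diff_conv2 linorder_not_le add.commute)
qed

lemma not_indep_family_append:
  assumes "x \<noteq> 0" "x \<in> span (v ` {..<a})" "x \<in> span (w ` {..<q})"
  shows "\<not> indep_family (a + q) (append_family a v w)"
proof
  assume ind: "indep_family (a + q) (append_family a v w)"
  obtain y z where y: "x = (\<Sum>i<a. y i *\<^sub>R v i)" and z: "x = (\<Sum>k<q. z k *\<^sub>R w k)"
    using span_image_lessThan assms(2,3) by metis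
  have "(\<Sum>i<a + q. append_family a y (\<lambda>k. - z k) i *\<^sub>R append_family a v w i) = 0"
    unfolding sum_append_family using y z by (simp add: append_family_def sum_negf)
  then have "\<forall>i<a + q. append_family a y (\<lambda>k. - z k) i = 0"
    using ind unfolding indep_family_def by blast
  then have "y i = 0" if "i < a" for i
    using that by (auto simp: append_family_def dest: spec[of _ i])
  then show False
    using y assms(1) by simp
qed

lemma indep_family_permute_take:
  assumes "indep_family a w" "\<theta> permutes {..<a}" "q \<le> a"
  shows "indep_family q (\<lambda>k. w (\<theta> k))"
  unfolding indep_family_def
proof (intro allI impI)
  fix z k
  assume z: "(\<Sum>k<q. z k *\<^sub>R w (\<theta> k)) = 0" and k: "k < q"
  define y where "y l = (if inv_into UNIV \<theta> l < q then z (inv_into UNIV \<theta> l) else 0)" for l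
  have y\<theta>: "y (\<theta> k) = (if k < q then z k else 0)" for k
    using permutes_inverses(2)[OF assms(2)] by (simp add: y_def)
  have "(\<Sum>l<a. y l *\<^sub>R w l) = (\<Sum>k<a. y (\<theta> k) *\<^sub>R w (\<theta> k))"
    using sum.permute[OF assms(2), of "\<lambda>l. y l *\<^sub>R w l"] by (simp add: o_def)
  also have "\<dots> = (\<Sum>k<q. z k *\<^sub>R w (\<theta> k))"
    by (rule sum.mono_neutral_cong_right) (use assms(3) in \<open>auto simp: y\<theta>\<close>)
  finally have "\<forall>l<a. y l = 0"
    using z assms(1) unfolding indep_family_def by simp
  moreover have "\<theta> k < a"
    using permutes_in_image[OF assms(2), of k] k assms(3) by simp
  ultimately show "z k = 0"
    using y\<theta>[of k] k by auto
qed

text \<open>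
  A count of dimensions inside \<open>Y\<close>: a space of dimension at least \<open>t\<close> and the span of
  \<open>a + 1 - t\<close> of the basis vectors cannot be independent in dimension \<open>a\<close>.
\<close>

lemma intersection_meets_partial_basis:
  fixes X Y :: "'v::real_vector set"
  assumes X: "subspace X" and Y: "subspace Y" "indep_family a w" "Y = span (w ` {..<a})"
    and t: "0 < t" "t \<le> a" "t \<le> dim (X \<inter> Y)" and \<theta>: "\<theta> permutes {..<a}"
  shows "\<exists>x. x \<noteq> 0 \<and> x \<in> X \<and> x \<in> span ((\<lambda>k. w (\<theta> k)) ` {..<Suc a - t})"
proof -
  define d where "d = dim (X \<inter> Y)"
  define q where "q = Suc a - t"
  have "0 < d"
    using t by (simp add: d_def)
  obtain c where c: "indep_family d c" "\<forall>i<d. c i \<in> X \<inter> Y" "X \<inter> Y = span (c ` {..<d})"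
    using subspace_basis_family[OF subspace_inter[OF X Y(1)] d_def[symmetric] \<open>0 < d\<close>] by blast
  have "append_family d c (\<lambda>k. w (\<theta> k)) i \<in> span (w ` {..<a})" if "i < d + q" for i
  proof (cases "i < d")
    case True
    then have "c i \<in> Y"
      using c(2) by blast
    then show ?thesis
      using True unfolding Y(3) by (simp add: append_family_def)
  next
    case False
    then have "i - d < a"
      using that t by (auto simp: q_def)
    then have "\<theta> (i - d) < a"
      using permutes_in_image[OF \<theta>, of "i - d"] by simp
    then show ?thesis
      using False by (auto simp: append_family_def intro: span_base)
  qed
  then have "\<not> indep_family (d + q) (append_family d c (\<lambda>k. w (\<theta> k)))"
    by (rule more_vectors_than_generators_dependent) (use t in \<open>auto simp: q_def d_def\<close>)
  moreover have "indep_family q (\<lambda>k. w (\<theta> k))"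
    using indep_family_permute_take[OF Y(2) \<theta>] t by (simp add: q_def)
  ultimately obtain x where "x \<noteq> 0" "x \<in> span (c ` {..<d})" "x \<in> span ((\<lambda>k. w (\<theta> k)) ` {..<q})"
    using indep_family_append[OF c(1)] by blast
  moreover have "span (c ` {..<d}) \<subseteq> X"
    using c(3) by blast
  ultimately show ?thesis
    unfolding q_def by blast
qed

section \<open>Determinants of vectors in given coordinates\<close>

lemma minor_functionals_eq_0:
  fixes e :: "nat \<Rightarrow> 'v::real_vector" and \<phi> :: "nat \<Rightarrow> 'v \<Rightarrow> real"
  assumes "\<And>c. linear (\<phi> c)" "\<not> indep_family k e"
  shows "minor k (\<lambda>l c. \<phi> c (e l)) \<mu> = 0"
proof -
  obtain z where z: "(\<Sum>l<k. z l *\<^sub>R e l) = 0" "\<exists>l<k. z l \<noteq> 0"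
    using assms(2) unfolding indep_family_def by blast
  have "(\<Sum>l<k. z l * \<phi> c (e l)) = \<phi> c (\<Sum>l<k. z l *\<^sub>R e l)" for c
    by (simp add: linear_sum[OF assms(1)] linear_scale[OF assms(1)])
  then show ?thesis
    unfolding minor_eq_0_iff using z linear_0[OF assms(1)] by auto
qed

lemma minor_functionals_nonzero:
  fixes e :: "nat \<Rightarrow> 'v::real_vector" and \<phi> :: "nat \<Rightarrow> 'v \<Rightarrow> real"
  assumes "\<And>c. linear (\<phi> c)" "indep_family n e"
    and "\<forall>u\<in>span (e ` {..<n}). (\<forall>c<n. \<phi> c u = 0) \<longrightarrow> u = 0"
  shows "minor n (\<lambda>l c. \<phi> c (e l)) id \<noteq> 0"
proof
  assume "minor n (\<lambda>l c. \<phi> c (e l)) id = 0"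
  then obtain z where z: "\<exists>l<n. z l \<noteq> 0" "\<forall>c<n. (\<Sum>l<n. z l * \<phi> c (e l)) = 0"
    by (auto simp: minor_eq_0_iff)
  define u where "u = (\<Sum>l<n. z l *\<^sub>R e l)"
  have "\<phi> c u = (\<Sum>l<n. z l * \<phi> c (e l))" for c
    by (simp add: u_def linear_sum[OF assms(1)] linear_scale[OF assms(1)])
  moreover have "u \<in> span (e ` {..<n})"
    unfolding u_def by (intro span_sum span_scale span_base) auto
  ultimately have "u = 0"
    using assms(3) z(2) by simp
  then show False
    using assms(2) z(1) unfolding indep_family_def u_def by blast
qed

section \<open>Passage to set families\<close>

text \<open>
  If the \<open>m\<close> functions had fewer than \<open>m\<close> leading sets, some nontrivial combination
  would vanish at all of these sets, and in particular at its own leading set.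
\<close>

lemma card_leading_sets_ge:
  assumes alt: "\<And>i. i < m \<Longrightarrow> alternating k (f i)"
    and ind: "\<And>z. \<exists>i<m. z i \<noteq> 0 \<Longrightarrow> support n k (\<lambda>\<sigma>. \<Sum>i<m. z i * f i \<sigma>) \<noteq> {}"
  shows "m \<le> card {S. \<exists>z. leading n k (\<lambda>\<sigma>. \<Sum>i<m. z i * f i \<sigma>) S}" (is "_ \<le> card ?L")
proof (rule ccontr)
  assume "\<not> m \<le> card ?L"
  have "?L \<subseteq> Pow {..<n}"
    by (auto simp: leading_def support_def)
  then have "finite ?L"
    by (rule finite_subset) simp
  have "\<forall>S\<in>?L. \<exists>\<sigma>. S = \<sigma> ` {..<k}"
    by (auto simp: leading_def support_def)
  from bchoice[OF this] obtain s where s: "\<forall>S\<in>?L. S = s S ` {..<k}"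
    by (elim exE)
  obtain z where z: "\<exists>i<m. z i \<noteq> 0" "\<forall>S\<in>?L. (\<Sum>i<m. z i * f i (s S)) = 0"
    using homogeneous_system_nontrivial[OF \<open>finite ?L\<close>, of m "\<lambda>i S. f i (s S)"] \<open>\<not> m \<le> card ?L\<close>
    by auto
  let ?F = "\<lambda>\<sigma>. \<Sum>i<m. z i * f i \<sigma>"
  obtain S where S: "leading n k ?F S"
    using leading_exists[OF ind[OF z(1)]] by blast
  then have "S \<in> ?L"
    by blast
  have "alternating k ?F"
    using alt by (intro alternating_linear_combination) simp
  then have "?F (s S) \<noteq> 0"
    using alternating_nonzero_on_support[of k ?F "s S" n] S s \<open>S \<in> ?L\<close> by (simp add: leading_def)
  then show False
    using z(2) \<open>S \<in> ?L\<close> by blast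
qed

text \<open>
  The coordinates are indexed from \<open>0\<close> while the ground set is \<open>{1..n}\<close>, so the
  family is shifted by \<open>Suc\<close>.
\<close>

lemma card_le_AK:
  assumes "L \<subseteq> Pow {..<n}" "\<And>S. S \<in> L \<Longrightarrow> card S = a"
    and "\<And>S T. S \<in> L \<Longrightarrow> T \<in> L \<Longrightarrow> t \<le> card (S \<inter> T)"
  shows "card L \<le> AK n a t"
proof -
  let ?F = "image Suc ` L"
  have "card ?F = card L"
    by (rule card_image) (auto intro!: inj_onI dest: inj_image_eq_iff[OF inj_Suc, THEN iffD1])
  moreover have "?F \<subseteq> Pow {1..n}"
    using assms(1) by fastforce
  moreover have "uniform_family a ?F"
    using assms(2) by (auto simp: uniform_family_def card_image)
  moreover have "t_intersecting t ?F"
    using assms(3) by (auto simp: t_intersecting_def card_image simp flip: image_Int)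
  moreover have "finite {card F | F. F \<subseteq> Pow {1..n} \<and> uniform_family a F \<and> t_intersecting t F}"
    by (rule finite_subset[of _ "card ` Pow (Pow {1..n})"]) auto
  ultimately show ?thesis
    unfolding AK_def by (intro Max_ge) (auto intro!: exI[of _ ?F])
qed

text \<open>
  The annihilation condition is bilinear, hence it passes from the functions \<open>f i\<close> to their
  whole span; there the product of leading terms forces any two leading sets to meet in at least
  \<open>t\<close> elements.
\<close>

lemma alternating_family_le_AK:
  assumes alt: "\<And>i. i < m \<Longrightarrow> alternating a (f i)"
    and ind: "\<And>z. \<exists>i<m. z i \<noteq> 0 \<Longrightarrow> support n a (\<lambda>\<sigma>. \<Sum>i<m. z i * f i \<sigma>) \<noteq> {}"
    and ann: "\<And>i j \<mu> \<rho>. i < m \<Longrightarrow> j < m \<Longrightarrow>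
      alt_product a (Suc a - t) (f i) (contract (Suc a - t) \<rho> (f j)) \<mu> = 0"
    and "t \<le> a"
  shows "m \<le> AK n a t"
proof -
  define F where "F z = (\<lambda>\<sigma>. \<Sum>i<m. z i * f i \<sigma>)" for z :: "nat \<Rightarrow> real"
  have F: "alternating a (F z)" for z
    unfolding F_def using alt by (intro alternating_linear_combination) simp
  have "alt_product a (Suc a - t) (F y) (contract (Suc a - t) \<rho> (F z)) \<mu> = 0" for y z \<rho> \<mu>
  proof -
    have "contract (Suc a - t) \<rho> (F z) = (\<lambda>\<tau>. \<Sum>j<m. z j * contract (Suc a - t) \<rho> (f j) \<tau>)"
      by (simp add: contract_def F_def fun_eq_iff)
    then show ?thesis
      unfolding F_def by (simp add: alt_product_sum_left alt_product_sum_right ann)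
  qed
  then have "t \<le> card (S \<inter> T)" if "leading n a (F y) S" "leading n a (F z) T" for S T y z
    using alt_product_contract_leading_nonzero[OF F F that _ \<open>t \<le> a\<close>] by (meson not_le)
  moreover have "S \<subseteq> {..<n}" "card S = a" if "leading n a (F z) S" for S z
    using support_card[OF F] that by (auto simp: leading_def)
  ultimately have "card {S. \<exists>z. leading n a (F z) S} \<le> AK n a t"
    by (intro card_le_AK) blast+
  moreover have "m \<le> card {S. \<exists>z. leading n a (F z) S}"
    unfolding F_def using alt ind by (rule card_leading_sets_ge)
  ultimately show ?thesis
    by simp
qed

section \<open>The bound for subspaces\<close>

theorem theorem5p1:
  fixes A B :: "nat \<Rightarrow> 'v::real_vector set"
    and t a b m :: nat
  assumes "0 < t" and "t \<le> a" and "a \<le> b"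
    and "\<And>i. i \<in> {1..m} \<Longrightarrow> subspace (A i) \<and> dim (A i) = a"
    and "\<And>i. i \<in> {1..m} \<Longrightarrow> subspace (B i) \<and> dim (B i) = b"
    and "\<And>i. i \<in> {1..m} \<Longrightarrow> dim (A i \<inter> B i) = 0"
    and "\<And>i j. 1 \<le> i \<Longrightarrow> i < j \<Longrightarrow> j \<le> m \<Longrightarrow> 0 < dim (A i \<inter> B j)"
    and "\<And>i j. i \<in> {1..m} \<Longrightarrow> j \<in> {1..m} \<Longrightarrow> t \<le> dim (A i \<inter> A j)"
  shows "m \<le> AK (a + b) a t"
proof -
  define A' B' where "A' i = A (Suc i)" and "B' i = B (Suc i)" for i
  have A': "subspace (A' i)" "dim (A' i) = a" and B': "subspace (B' i)" "dim (B' i) = b"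
    if "i < m" for i
    using assms(4,5)[of "Suc i"] that by (auto simp: A'_def B'_def)
  have "0 < a" "0 < b"
    using assms(1-3) by simp_all
  have "\<forall>i\<in>{..<m}. \<exists>e. indep_family a e \<and> A' i = span (e ` {..<a})"
  proof
    fix i assume "i \<in> {..<m}"
    then have "i < m"
      by simp
    then show "\<exists>e. indep_family a e \<and> A' i = span (e ` {..<a})"
      using subspace_basis_family[OF A'[of i] \<open>0 < a\<close>] by blast
  qed
  then obtain v where v: "\<forall>i\<in>{..<m}. indep_family a (v i) \<and> A' i = span (v i ` {..<a})"
    by metis
  have "\<forall>i\<in>{..<m}. \<exists>e. indep_family b e \<and> B' i = span (e ` {..<b})"
  proof
    fix i assume "i \<in> {..<m}"
    then have "i < m"
      by simp
    then show "\<exists>e. indep_family b e \<and> B' i = span (e ` {..<b})"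
      using subspace_basis_family[OF B'[of i] \<open>0 < b\<close>] by blast
  qed
  then obtain w where w: "\<forall>i\<in>{..<m}. indep_family b (w i) \<and> B' i = span (w i ` {..<b})"
    by metis
  have trivial_Int: "A' i \<inter> B' i \<subseteq> {0}" if "i < m" for i
  proof -
    obtain C where C: "C \<subseteq> A' i \<inter> B' i" "independent C" "A' i \<inter> B' i \<subseteq> span C"
      "card C = dim (A' i \<inter> B' i)"
      by (rule basis_exists[of "A' i \<inter> B' i"])
    have "card C = 0"
      unfolding C(4) using assms(6)[of "Suc i"] that by (simp add: A'_def B'_def)
    have "A' i = span (v i ` {..<a})"
      using v that by blast
    then have "C \<subseteq> span (v i ` {..<a})"
      using C(1) by blast
    then have "finite C"
      using independent_span_bound[of "v i ` {..<a}" C] C(2) by simp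
    then show ?thesis
      using C(3) \<open>card C = 0\<close> by simp
  qed
  have nonzero_Int: "\<exists>x. x \<noteq> 0 \<and> x \<in> A' i \<and> x \<in> B' j" if "i < j" "j < m" for i j
  proof (rule ccontr)
    assume "\<not> ?thesis"
    then have "A' i \<inter> B' j \<subseteq> {0}"
      by blast
    then have "A' i \<inter> B' j \<subseteq> span {}"
      by simp
    then have "dim (A' i \<inter> B' j) = 0"
      using dim_le_card[of "A' i \<inter> B' j" "{}"] by simp
    then show False
      using assms(7)[of "Suc i" "Suc j"] that by (simp add: A'_def B'_def)
  qed
  define e where "e i j = append_family a (v i) (w j)" for i j
  have "\<exists>\<phi> :: nat \<Rightarrow> 'v \<Rightarrow> real. (\<forall>c. linear (\<phi> c)) \<and>
      (\<forall>i\<in>{..<m}. \<forall>u\<in>span (e i i ` {..<a + b}). (\<forall>c<a + b. \<phi> c u = 0) \<longrightarrow> u = 0)"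
  proof (rule generic_functionals)
    show "finite (e i i ` {..<a + b}) \<and> card (e i i ` {..<a + b}) \<le> a + b" for i
      using card_image_le[of "{..<a + b}" "e i i"] by simp
  qed simp
  then obtain \<phi> :: "nat \<Rightarrow> 'v \<Rightarrow> real" where \<phi>_all: "\<forall>c. linear (\<phi> c)"
    and \<phi>_inj: "\<forall>i\<in>{..<m}. \<forall>u\<in>span (e i i ` {..<a + b}). (\<forall>c<a + b. \<phi> c u = 0) \<longrightarrow> u = 0"
    by (elim exE conjE)
  have \<phi>: "linear (\<phi> c)" for c
    using \<phi>_all by (rule spec)
  define V W where "V i l c = \<phi> c (v i l)" and "W j k c = \<phi> c (w j k)" for i j l k c
  \<comment> \<open>The matrix \<open>d\<close> is triangular with nonzero diagonal: \<open>d i j\<close> is the volume of the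
      basis of \<open>A' i\<close> together with that of \<open>B' j\<close> in the chosen coordinates.\<close>
  define d where "d i j = minor (a + b) (append_family a (V i) (W j)) id" for i j
  have d: "d i j = minor (a + b) (\<lambda>l c. \<phi> c (e i j l)) id" for i j
    unfolding d_def by (rule arg_cong[of _ _ "\<lambda>M. minor (a + b) M id"])
      (auto simp: fun_eq_iff append_family_def e_def V_def W_def)
  have d_diag: "d i i \<noteq> 0" if "i < m" for i
  proof -
    have "indep_family (a + b) (e i i)"
      unfolding e_def using v w trivial_Int that by (intro indep_family_append) auto
    then show ?thesis
      unfolding d using \<phi>_inj that by (intro minor_functionals_nonzero[OF \<phi>]) simp_all
  qed
  have d_upper: "d i j = 0" if ij: "i < j" "j < m" for i j
  proof -
    obtain x where "x \<noteq> 0" "x \<in> A' i" "x \<in> B' j"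
      using nonzero_Int[OF ij] by blast
    then have "\<not> indep_family (a + b) (e i j)"
      unfolding e_def using v w ij by (intro not_indep_family_append[of x]) auto
    then show ?thesis
      unfolding d by (rule minor_functionals_eq_0[OF \<phi>])
  qed
  show ?thesis
  proof (rule alternating_family_le_AK)
    show "alternating a (minor a (V i))" for i
      by (rule alternating_minor)
    show "t \<le> a"
      by fact
    show "alt_product a (Suc a - t) (minor a (V i)) (contract (Suc a - t) \<rho> (minor a (V j))) \<mu> = 0"
      if ij: "i < m" "j < m" for i j \<mu> \<rho>
    proof (rule alt_product_contract_eq_0)
      show "Suc a - t \<le> a"
        using assms(1,2) by simp
      fix \<theta> assume \<theta>: "\<theta> permutes {..<a}"
      have "t \<le> dim (A' i \<inter> A' j)"
        using assms(8)[of "Suc i" "Suc j"] ij by (simp add: A'_def)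
      moreover have "indep_family a (v j)" "A' j = span (v j ` {..<a})" "A' i = span (v i ` {..<a})"
        using v ij by simp_all
      ultimately obtain x where x: "x \<noteq> 0" "x \<in> span (v i ` {..<a})"
          "x \<in> span ((\<lambda>k. v j (\<theta> k)) ` {..<Suc a - t})"
        using intersection_meets_partial_basis[OF A'(1)[OF ij(1)] A'(1)[OF ij(2)] _ _ assms(1,2) _ \<theta>]
        by metis
      then have "\<not> indep_family (a + (Suc a - t)) (append_family a (v i) (\<lambda>k. v j (\<theta> k)))"
        by (rule not_indep_family_append)
      then have "minor (a + (Suc a - t)) (\<lambda>l c. \<phi> c (append_family a (v i) (\<lambda>k. v j (\<theta> k)) l)) \<mu> = 0"
        by (rule minor_functionals_eq_0[OF \<phi>])
      moreover have "(\<lambda>l c. \<phi> c (append_family a (v i) (\<lambda>k. v j (\<theta> k)) l))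
          = append_family a (V i) (\<lambda>k. V j (\<theta> k))"
        by (auto simp: fun_eq_iff append_family_def V_def)
      ultimately show "minor (a + (Suc a - t)) (append_family a (V i) (\<lambda>k. V j (\<theta> k))) \<mu> = 0"
        by simp
    qed
    show "support (a + b) a (\<lambda>\<sigma>. \<Sum>i<m. z i * minor a (V i) \<sigma>) \<noteq> {}" if "\<exists>i<m. z i \<noteq> 0" for z
    proof -
      let ?F = "\<lambda>\<sigma>. \<Sum>i<m. z i * minor a (V i) \<sigma>"
      \<comment> \<open>Pairing with \<open>B' j\<close> for the last \<open>j\<close> with \<open>z j \<noteq> 0\<close> isolates the term \<open>d j j\<close>.\<close>
      define j where "j = Max {i. i < m \<and> z i \<noteq> 0}"
      have "j \<in> {i. i < m \<and> z i \<noteq> 0}"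
        unfolding j_def using that by (intro Max_in) auto
      then have j: "j < m" "z j \<noteq> 0"
        by auto
      have above: "z i = 0" if "i < m" "j < i" for i
        using that Max_ge[of "{i. i < m \<and> z i \<noteq> 0}" i] by (fastforce simp: j_def)
      have "alt_product a b ?F (\<lambda>\<tau>. \<Prod>k<b. W j k (\<tau> k)) id = (\<Sum>i<m. z i * (fact a * d i j))"
        by (simp add: alt_product_sum_left alt_product_minor_simple d_def)
      also have "\<dots> = (\<Sum>i<m. if i = j then z j * (fact a * d j j) else 0)"
      proof (rule sum.cong)
        fix i assume "i \<in> {..<m}"
        then show "z i * (fact a * d i j) = (if i = j then z j * (fact a * d j j) else 0)"
          using above[of i] d_upper[of i j] j(1) by (cases i j rule: linorder_cases) auto
      qed simp
      also have "\<dots> = z j * (fact a * d j j)"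
        using j(1) by simp
      finally have nz: "alt_product a b ?F (\<lambda>\<tau>. \<Prod>k<b. W j k (\<tau> k)) id \<noteq> 0"
        using j d_diag by simp
      have "\<exists>\<pi>. \<pi> permutes {..<a + b} \<and> ?F \<pi> \<noteq> 0"
      proof (rule ccontr)
        assume "\<nexists>\<pi>. \<pi> permutes {..<a + b} \<and> ?F \<pi> \<noteq> 0"
        then have "alt_product a b ?F (\<lambda>\<tau>. \<Prod>k<b. W j k (\<tau> k)) id = 0"
          unfolding alt_product_def by (intro sum.neutral) simp
        with nz show False
          by (rule notE)
      qed
      then obtain \<pi> where \<pi>: "\<pi> permutes {..<a + b}" "?F \<pi> \<noteq> 0"
        by (elim exE conjE)
      have "\<pi> ` {..<a} \<subseteq> \<pi> ` {..<a + b}"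
        by (rule image_mono) simp
      also have "\<dots> = {..<a + b}"
        using \<pi>(1) by (rule permutes_image)
      finally have "\<pi> ` {..<a} \<in> support (a + b) a ?F"
        using \<pi>(2) unfolding support_def by blast
      then show ?thesis
        by blast
    qed
  qed
qed

end
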